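(* Let $d\ge1$ and let $\lambda=(\lambda_{J,\tau})_{(J,\tau)\in\mathcal G_d}$ be a complete signed tail family. Then there is a unique real system $w=(w_{I,\sigma})_{(I,\sigma)\in\mathcal G_d}$ satisfying the incidence relations $$\lambda_{J,\tau}=\sum_{I\supseteq J}\ \sum_{\sigma\in\{\mathrm L,\mathrm U\}^I:\,\sigma|_J=\tau}w_{I,\sigma},\qquad (J,\tau)\in\mathcal G_d,$$ and it is recovered recursively, by descending active-set size $|I|$ from $d$ down to $1$, via $$w_{I,\sigma}=\lambda_{I,\sigma}-\sum_{K\supsetneq I}\ \sum_{\rho\in\{\mathrm L,\mathrm U\}^K:\,\rho|_I=\sigma}w_{K,\rho},\qquad (I,\sigma)\in\mathcal G_d.$$
   Context: $[d]=\{1,\dots,d\}$; $\mathcal G_d=\{(I,\sigma):\emptyset\ne I\subseteq[d],\ \sigma\in\{\mathrm L,\mathrm U\}^I\}$, where $\{\mathrm L,\mathrm U\}^I$ is the set of functions $I\to\{\mathrm L,\mathrm U\}$. A complete signed tail family is a real family indexed by all $(J,\tau)\in\mathcal G_d$. *)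

theory Defs
  imports Complex_Main "HOL-Library.FuncSet"
begin

datatype side = L | U

definition signed_indices :: "nat \<Rightarrow> (nat set \<times> (nat \<Rightarrow> side)) set" where
  "signed_indices d = {(I, \<sigma>). I \<noteq> {} \<and> I \<subseteq> {1..d} \<and> \<sigma> \<in> I \<rightarrow>\<^sub>E {L, U}}"

text \<open>Families are extensional functions, so that equality of families is equality on the
  index set and \<open>\<exists>!\<close> has its intended meaning.\<close>

definition signed_families :: "nat \<Rightarrow> (nat set \<times> (nat \<Rightarrow> side) \<Rightarrow> real) set" where
  "signed_families d = signed_indices d \<rightarrow>\<^sub>E UNIV"

definition sign_extensions :: "nat set \<Rightarrow> nat set \<Rightarrow> (nat \<Rightarrow> side) \<Rightarrow> (nat \<Rightarrow> side) set" where
  "sign_extensions K J \<tau> = {\<rho> \<in> K \<rightarrow>\<^sub>E {L, U}. restrict \<rho> J = \<tau>}"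

definition incidence ::
  "nat \<Rightarrow> (nat set \<times> (nat \<Rightarrow> side) \<Rightarrow> real) \<Rightarrow> (nat set \<times> (nat \<Rightarrow> side) \<Rightarrow> real) \<Rightarrow> bool" where
  "incidence d lam w \<longleftrightarrow> (\<forall>(J, \<tau>) \<in> signed_indices d.
     lam (J, \<tau>) = (\<Sum>I | J \<subseteq> I \<and> I \<subseteq> {1..d}. \<Sum>\<sigma> \<in> sign_extensions I J \<tau>. w (I, \<sigma>)))"

definition descent ::
  "nat \<Rightarrow> (nat set \<times> (nat \<Rightarrow> side) \<Rightarrow> real) \<Rightarrow> (nat set \<times> (nat \<Rightarrow> side) \<Rightarrow> real)
    \<Rightarrow> nat set \<Rightarrow> (nat \<Rightarrow> side) \<Rightarrow> real" where
  "descent d lam w I \<sigma> =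
     lam (I, \<sigma>) - (\<Sum>K | I \<subset> K \<and> K \<subseteq> {1..d}. \<Sum>\<rho> \<in> sign_extensions K I \<sigma>. w (K, \<rho>))"

text \<open>\<open>recovered d lam k\<close> is the state after \<open>k\<close> steps of the recursion: the entries with
  \<open>card I > d - k\<close> have been computed, and all others are \<open>undefined\<close>. Step \<open>k + 1\<close> fills in the
  entries with \<open>card I = d - k\<close>, so \<open>d\<close> steps run through the sizes \<open>d, \<dots>, 1\<close>.\<close>

primrec recovered ::
  "nat \<Rightarrow> (nat set \<times> (nat \<Rightarrow> side) \<Rightarrow> real) \<Rightarrow> nat \<Rightarrow> (nat set \<times> (nat \<Rightarrow> side) \<Rightarrow> real)" where
  "recovered d lam 0 = (\<lambda>_. undefined)"
| "recovered d lam (Suc k) = (\<lambda>(I, \<sigma>).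
     if (I, \<sigma>) \<in> signed_indices d \<and> card I = d - k
     then descent d lam (recovered d lam k) I \<sigma>
     else recovered d lam k (I, \<sigma>))"

end

theory Submission
  imports Defs
begin

text \<open>
  The incidence relations form a triangular system for inclusion of active sets: in the relation
  indexed by \<open>(J, \<tau>)\<close> the set \<open>I = J\<close> contributes the single term \<open>w (J, \<tau>)\<close>, because \<open>\<tau>\<close> is its
  own only extension to \<open>J\<close>, and every other term has a strictly larger active set. Solving each
  relation for this diagonal term shows that the incidence relations hold exactly when every
  entry satisfies the descent equation (\<open>incidence_iff_descent\<close>).

  A descent equation refers only to entries with a larger active set, so induction on the number
  of completed steps determines all entries. Read for a given solution, it says that the
  recursion reproduces this solution (\<open>recovered_eq_solution\<close>), which gives uniqueness together
  with the recovery formula. Read for the recursion itself, it says that the final state solves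
  the descent equations (\<open>recovered_descent\<close>): an entry is computed from larger active sets whose
  entries are already present and are never overwritten (\<open>recovered_stable\<close>).
\<close>

lemma finite_signed_index:
  "(I, \<sigma>) \<in> signed_indices d \<Longrightarrow> finite I"
  by (auto simp: signed_indices_def intro: finite_subset)

lemma card_signed_index:
  assumes "(I, \<sigma>) \<in> signed_indices d"
  shows "1 \<le> card I" and "card I \<le> d"
proof -
  have "I \<noteq> {}" "I \<subseteq> {1..d}"
    using assms by (auto simp: signed_indices_def)
  then show "1 \<le> card I" "card I \<le> d"
    using card_mono[of "{1..d}" I] finite_signed_index[OF assms]
    by (auto simp: Suc_le_eq card_gt_0_iff)
qed

lemma signed_index_extension:
  assumes "(I, \<sigma>) \<in> signed_indices d" "I \<subseteq> K" "K \<subseteq> {1..d}" "\<rho> \<in> sign_extensions K I \<sigma>"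
  shows "(K, \<rho>) \<in> signed_indices d"
  using assms by (auto simp: signed_indices_def sign_extensions_def)

lemma card_less_signed_index:
  "(K, \<rho>) \<in> signed_indices d \<Longrightarrow> I \<subset> K \<Longrightarrow> card I < card K"
  by (simp add: finite_signed_index psubset_card_mono)

lemma sign_extensions_self:
  assumes "\<sigma> \<in> I \<rightarrow>\<^sub>E {L, U}"
  shows "sign_extensions I I \<sigma> = {\<sigma>}"
  using assms by (auto simp: sign_extensions_def PiE_def extensional_restrict)

lemma incidence_iff_descent:
  "incidence d lam w \<longleftrightarrow> (\<forall>(I, \<sigma>) \<in> signed_indices d. w (I, \<sigma>) = descent d lam w I \<sigma>)"
proof -
  have "lam (I, \<sigma>) = (\<Sum>K | I \<subseteq> K \<and> K \<subseteq> {1..d}. \<Sum>\<rho> \<in> sign_extensions K I \<sigma>. w (K, \<rho>))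
      \<longleftrightarrow> w (I, \<sigma>) = descent d lam w I \<sigma>" if "(I, \<sigma>) \<in> signed_indices d" for I \<sigma>
  proof -
    have I: "I \<subseteq> {1..d}" and \<sigma>: "\<sigma> \<in> I \<rightarrow>\<^sub>E {L, U}"
      using that by (auto simp: signed_indices_def)
    have "{K. I \<subseteq> K \<and> K \<subseteq> {1..d}} = insert I {K. I \<subset> K \<and> K \<subseteq> {1..d}}"
      using I by auto
    moreover have "finite {K. I \<subset> K \<and> K \<subseteq> {1..d}}"
      by (rule finite_subset[of _ "Pow {1..d}"]) auto
    ultimately show ?thesis
      using sign_extensions_self[OF \<sigma>] by (auto simp: descent_def)
  qed
  then show ?thesis
    unfolding incidence_def by fast
qed

lemma descent_cong:
  assumes "\<And>K \<rho>. I \<subset> K \<Longrightarrow> K \<subseteq> {1..d} \<Longrightarrow> \<rho> \<in> sign_extensions K I \<sigma> \<Longrightarrow> v (K, \<rho>) = w (K, \<rho>)"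
  shows "descent d lam v I \<sigma> = descent d lam w I \<sigma>"
  using assms by (auto simp: descent_def intro!: sum.cong)

lemma recovered_stable:
  assumes "k \<le> m" and "d - k < card I"
  shows "recovered d lam m (I, \<sigma>) = recovered d lam k (I, \<sigma>)"
  using assms(1)
proof (induction m rule: dec_induct)
  case base
  show ?case ..
next
  case (step m)
  then show ?case
    using assms(2) by auto
qed

lemma recovered_in_signed_families: "recovered d lam k \<in> signed_families d"
  by (induction k) (auto simp: signed_families_def PiE_def extensional_def)

lemma recovered_descent:
  assumes "(I, \<sigma>) \<in> signed_indices d"
  shows "recovered d lam d (I, \<sigma>) = descent d lam (recovered d lam d) I \<sigma>"
proof -
  \<comment> \<open>After this many steps exactly the sets with more elements than \<open>I\<close> have been handled.\<close>
  define k where "k = d - card I"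
  have k: "Suc k \<le> d" "card I = d - k"
    using card_signed_index[OF assms] by (auto simp: k_def)
  have "recovered d lam d (I, \<sigma>) = recovered d lam (Suc k) (I, \<sigma>)"
    using k by (intro recovered_stable) auto
  also have "\<dots> = descent d lam (recovered d lam k) I \<sigma>"
    using assms k by simp
  also have "\<dots> = descent d lam (recovered d lam d) I \<sigma>"
  proof (rule descent_cong)
    fix K \<rho>
    assume K: "I \<subset> K" "K \<subseteq> {1..d}" "\<rho> \<in> sign_extensions K I \<sigma>"
    then have "card I < card K"
      using signed_index_extension[OF assms] card_less_signed_index by blast
    then show "recovered d lam k (K, \<rho>) = recovered d lam d (K, \<rho>)"
      using k by (intro recovered_stable[symmetric]) auto
  qed
  finally show ?thesis .
qed

text \<open>
  The entries not yet reached carry the default value, and so do the entries of a family outside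
  the index set. The intermediate states are therefore truncations of the solution by size of the
  active set; after \<open>d\<close> steps nothing is cut off, since active sets are nonempty.
\<close>

lemma recovered_eq_solution:
  assumes "w \<in> signed_families d"
    and w: "\<And>I \<sigma>. (I, \<sigma>) \<in> signed_indices d \<Longrightarrow> w (I, \<sigma>) = descent d lam w I \<sigma>"
  shows "w = recovered d lam d"
proof -
  have truncation: "recovered d lam k (I, \<sigma>) =
      (if (I, \<sigma>) \<in> signed_indices d \<and> d - k < card I then w (I, \<sigma>) else undefined)"
    if "k \<le> d" for k I \<sigma>
    using that
  proof (induction k arbitrary: I \<sigma>)
    case 0
    then show ?case
      by (auto dest: card_signed_index(2))
  next
    case (Suc k)
    show ?case
    proof (cases "(I, \<sigma>) \<in> signed_indices d \<and> card I = d - k")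
      case True
      have "descent d lam (recovered d lam k) I \<sigma> = descent d lam w I \<sigma>"
      proof (rule descent_cong)
        fix K \<rho>
        assume K: "I \<subset> K" "K \<subseteq> {1..d}" "\<rho> \<in> sign_extensions K I \<sigma>"
        then have "(K, \<rho>) \<in> signed_indices d"
          using True signed_index_extension by blast
        moreover from this have "d - k < card K"
          using card_less_signed_index[OF _ K(1)] True by metis
        ultimately show "recovered d lam k (K, \<rho>) = w (K, \<rho>)"
          using Suc by simp
      qed
      then show ?thesis
        using True w Suc.prems by auto
    next
      case False
      then have "(I, \<sigma>) \<in> signed_indices d \<Longrightarrow> d - Suc k < card I \<longleftrightarrow> d - k < card I"
        using Suc.prems by auto
      with False show ?thesis
        using Suc by auto
    qed
  qed
  show ?thesis
  proof
    fix p :: "nat set \<times> (nat \<Rightarrow> side)"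
    obtain I \<sigma> where p: "p = (I, \<sigma>)"
      by fastforce
    show "w p = recovered d lam d p"
    proof (cases "(I, \<sigma>) \<in> signed_indices d")
      case True
      with card_signed_index(1)[OF True] show ?thesis
        using truncation[of d I \<sigma>] by (simp add: p)
    next
      case False
      with assms(1) have "w (I, \<sigma>) = undefined"
        unfolding signed_families_def by (rule PiE_arb)
      with False show ?thesis
        using truncation[of d I \<sigma>] by (simp add: p)
    qed
  qed
qed

theorem proposition2:
  fixes d :: nat and lam :: "nat set \<times> (nat \<Rightarrow> side) \<Rightarrow> real"
  assumes "d \<ge> 1" and "lam \<in> signed_families d"
  shows "(\<exists>!w. w \<in> signed_families d \<and> incidence d lam w) \<and>
    (\<forall>w \<in> signed_families d. incidence d lam w \<longrightarrow>
      (\<forall>(I, \<sigma>) \<in> signed_indices d. w (I, \<sigma>) = descent d lam w I \<sigma>) \<and>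
      w = recovered d lam d)"
proof -
  have exists: "incidence d lam (recovered d lam d)"
    using recovered_descent by (auto simp: incidence_iff_descent)
  have unique: "w = recovered d lam d" if "w \<in> signed_families d" "incidence d lam w" for w
    using that by (intro recovered_eq_solution) (auto simp: incidence_iff_descent)
  have "\<exists>!w. w \<in> signed_families d \<and> incidence d lam w"
    using exists recovered_in_signed_families unique by blast
  with unique show ?thesis
    by (simp add: incidence_iff_descent)
qed

end
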